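(* Let $f$ be a Lipschitz function for which there exists a constant $\lambda>0$ such that $f(t)\ge\lambda t$ for all $t>0$, and let $\Omega$ be an $f$-extremal domain of $\mathbb{R}^2$, with corresponding solution $u$. Then the following properties hold: (T4) There exists a positive constant $R$ such that $\overline{\Omega}$ does not contain any closed ball of radius $R$. (T5) There exists a positive constant $h_0$ such that every connected component of $\{x\in\Omega \mid u(x)>h_0\}$ is contained in a ball of radius $\frac{\sqrt5}{2}R$ (with $R$ the constant in (T4)).
   Context: Let $\Omega\subset\mathbb{R}^2$ be a connected open set with boundary of class $C^2$ and $f:[0,+\infty)\to\mathbb{R}$ a Lipschitz function. $\Omega$ is called $f$-extremal if there exist a constant $\alpha\le 0$ and a function $u\in C^2(\overline\Omega)$ (the solution) with $\Delta u+f(u)=0$ and $u>0$ in $\Omega$, $u=0$ and $\langle\nabla u,\nu\rangle=\alpha$ on $\partial\Omega$, where $\nu$ is the outward unit normal to $\partial\Omega$. *)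

theory Defs
  imports "HOL-Analysis.Analysis"
begin

definition C2_real_on :: "real set \<Rightarrow> (real \<Rightarrow> real) \<Rightarrow> bool" where
  "C2_real_on I g \<longleftrightarrow>
     (\<exists>g' g''. (\<forall>s\<in>I. (g has_real_derivative g' s) (at s) \<and>
                     (g' has_real_derivative g'' s) (at s)) \<and>
              continuous_on I g'')"

text \<open>
  In the orthonormal frame \<open>(\<tau>, n)\<close> centred at \<open>p\<close>, the set \<open>\<Omega>\<close> is, near \<open>p\<close>, exactly the
  part strictly below the graph of the \<open>C\<^sup>2\<close> function \<open>g\<close>. For \<open>p\<close> in the boundary this forces
  \<open>g 0 = 0\<close>, and the boundary of \<open>\<Omega>\<close> near \<open>p\<close> is the graph of \<open>g\<close>.
\<close>

definition below_C2_graph ::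
  "(real^2) set \<Rightarrow> real^2 \<Rightarrow> real^2 \<Rightarrow> real^2 \<Rightarrow> (real \<Rightarrow> real) \<Rightarrow> bool" where
  "below_C2_graph \<Omega> p \<tau> n g \<longleftrightarrow>
     norm \<tau> = 1 \<and> norm n = 1 \<and> \<tau> \<bullet> n = 0 \<and>
     (\<exists>r>0. C2_real_on {-r<..<r} g \<and>
        (\<forall>y\<in>ball p r. y \<in> \<Omega> \<longleftrightarrow> (y - p) \<bullet> n < g ((y - p) \<bullet> \<tau>)))"

definition C2_boundary :: "(real^2) set \<Rightarrow> bool" where
  "C2_boundary \<Omega> \<longleftrightarrow> (\<forall>p\<in>frontier \<Omega>. \<exists>\<tau> n g. below_C2_graph \<Omega> p \<tau> n g)"

text \<open>
  The vector below is the unit normal at \<open>p\<close> to the graph of \<open>g\<close> that points upwards, hence out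
  of \<open>\<Omega>\<close>. It does not depend on the chosen frame and graph function.
\<close>

definition outward_unit_normal :: "(real^2) set \<Rightarrow> real^2 \<Rightarrow> real^2 \<Rightarrow> bool" where
  "outward_unit_normal \<Omega> p \<nu> \<longleftrightarrow>
     (\<exists>\<tau> n g. below_C2_graph \<Omega> p \<tau> n g \<and> \<nu> = sgn (n - deriv g 0 *\<^sub>R \<tau>))"

text \<open>
  \<open>u\<close> belongs to \<open>C\<^sup>2\<close> of the closure of \<open>\<Omega>\<close>: it is twice differentiable in \<open>\<Omega>\<close>, and \<open>u\<close>, its
  gradient \<open>Du\<close> and its Hessian \<open>D2u\<close> are continuous up to the boundary. On the boundary, \<open>Du\<close>
  and \<open>D2u\<close> are the (unique) continuous extensions from \<open>\<Omega>\<close>.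
\<close>

definition C2_closure ::
  "(real^2) set \<Rightarrow> (real^2 \<Rightarrow> real) \<Rightarrow> (real^2 \<Rightarrow> real^2) \<Rightarrow> (real^2 \<Rightarrow> real^2^2) \<Rightarrow> bool" where
  "C2_closure \<Omega> u Du D2u \<longleftrightarrow>
     (\<forall>x\<in>\<Omega>. GDERIV u x :> Du x \<and> (Du has_derivative (\<lambda>h. D2u x *v h)) (at x)) \<and>
     continuous_on (closure \<Omega>) u \<and>
     continuous_on (closure \<Omega>) Du \<and>
     continuous_on (closure \<Omega>) D2u"

text \<open>The Laplacian of \<open>u\<close> is the trace of its Hessian.\<close>

definition extremal_solution :: "(real \<Rightarrow> real) \<Rightarrow> (real^2) set \<Rightarrow> (real^2 \<Rightarrow> real) \<Rightarrow> bool" where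
  "extremal_solution f \<Omega> u \<longleftrightarrow>
     (\<exists>\<alpha>\<le>0. \<exists>Du D2u. C2_closure \<Omega> u Du D2u \<and>
        (\<forall>x\<in>\<Omega>. trace (D2u x) + f (u x) = 0 \<and> u x > 0) \<and>
        (\<forall>p\<in>frontier \<Omega>. u p = 0 \<and> (\<forall>\<nu>. outward_unit_normal \<Omega> p \<nu> \<longrightarrow> Du p \<bullet> \<nu> = \<alpha>)))"

definition extremal_domain :: "(real \<Rightarrow> real) \<Rightarrow> (real^2) set \<Rightarrow> bool" where
  "extremal_domain f \<Omega> \<longleftrightarrow>
     open \<Omega> \<and> connected \<Omega> \<and> C2_boundary \<Omega> \<and> (\<exists>u. extremal_solution f \<Omega> u)"

end

theory Submission
  imports Defs
begin

text \<open>
  On a ball of radius \<open>3\<pi> / \<surd>\<lambda>\<close> one can compare \<open>u\<close> with a multiple of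
  \<open>cos (a x) cos (a y)\<close>, \<open>a = \<surd>\<lambda> / 2\<close>, on a square; touching from below contradicts
  \<open>\<Delta>u + \<lambda>u \<le> 0\<close>. This bounds the inradius of \<open>\<Omega>\<close>.

  It follows that \<open>u\<close> is bounded, so that for large \<open>h\<^sub>0\<close> the set \<open>{u > h\<^sub>0}\<close> is even empty.
  Indeed, if \<open>u\<close> is large at some point, then, after moving to a suitable nearby point \<open>x\<^sub>1\<close>,
  a doubling-of-variables argument (using \<open>-F \<le> \<Delta>u \<le> 0\<close> with \<open>F\<close> linear in \<open>u(x\<^sub>1)\<close>) shows that \<open>u\<close> is
  at least \<open>u(x\<^sub>1)/2\<close> on a small circle around \<open>x\<^sub>1\<close>. As \<open>u\<close> is superharmonic, the barrier
  \<open>c (1/\<bar>x - x\<^sub>1\<bar>\<^sup>2 - 1/d\<^sup>2)\<close> on the annulus reaching the nearest boundary point forces a normal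
  derivative there that is more negative than \<open>\<alpha>\<close>. All maximum principles reduce to the sign of
  second derivatives along lines.
\<close>

definition has_second_derivative :: "(real \<Rightarrow> real) \<Rightarrow> real \<Rightarrow> bool" where
  "has_second_derivative h c \<longleftrightarrow>
     (\<exists>h'. (\<forall>\<^sub>F t in nhds 0. (h has_real_derivative h' t) (at t)) \<and>
           (h' has_real_derivative c) (at 0))"

lemma has_second_derivativeI:
  assumes "\<forall>\<^sub>F t in nhds 0. (h has_real_derivative h' t) (at t)"
    and "(h' has_real_derivative c) (at 0)"
  shows "has_second_derivative h c"
  using assms unfolding has_second_derivative_def by blast

lemma has_second_derivative_diff:
  assumes "has_second_derivative h c" "has_second_derivative k d"
  shows "has_second_derivative (\<lambda>t. h t - k t) (c - d)"
proof -
  obtain h' where h: "\<forall>\<^sub>F t in nhds 0. (h has_real_derivative h' t) (at t)"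
    "(h' has_real_derivative c) (at 0)"
    using assms unfolding has_second_derivative_def by blast
  obtain k' where k: "\<forall>\<^sub>F t in nhds 0. (k has_real_derivative k' t) (at t)"
    "(k' has_real_derivative d) (at 0)"
    using assms unfolding has_second_derivative_def by blast
  have "\<forall>\<^sub>F t in nhds 0. ((\<lambda>t. h t - k t) has_real_derivative h' t - k' t) (at t)"
    using h(1) k(1) by eventually_elim (rule DERIV_diff)
  then show ?thesis
    using DERIV_diff[OF h(2) k(2)] by (rule has_second_derivativeI)
qed

lemma has_second_derivative_cmult:
  assumes "has_second_derivative h c"
  shows "has_second_derivative (\<lambda>t. a * h t) (a * c)"
proof -
  obtain h' where h: "\<forall>\<^sub>F t in nhds 0. (h has_real_derivative h' t) (at t)"
    "(h' has_real_derivative c) (at 0)"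
    using assms unfolding has_second_derivative_def by blast
  have "\<forall>\<^sub>F t in nhds 0. ((\<lambda>t. a * h t) has_real_derivative a * h' t) (at t)"
    using h(1) by eventually_elim (rule DERIV_cmult)
  then show ?thesis
    using DERIV_cmult[OF h(2)] by (rule has_second_derivativeI)
qed

lemma has_second_derivative_local_max:
  assumes "has_second_derivative h c" and max: "\<forall>\<^sub>F t in nhds 0. h t \<le> h 0"
  shows "c \<le> 0"
proof (rule ccontr)
  assume "\<not> c \<le> 0"
  then have "c > 0" by simp
  obtain h' where h: "\<forall>\<^sub>F t in nhds 0. (h has_real_derivative h' t) (at t)"
    "(h' has_real_derivative c) (at 0)"
    using assms unfolding has_second_derivative_def by blast
  obtain e where e: "e > 0"
    "\<And>t. dist t 0 < e \<Longrightarrow> (h has_real_derivative h' t) (at t) \<and> h t \<le> h 0"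
    using eventually_conj[OF h(1) max] unfolding eventually_nhds_metric by blast
  have "h' 0 = 0"
    by (rule DERIV_local_max[of h _ 0 e]) (use e in \<open>auto simp: dist_real_def\<close>)
  obtain d where d: "d > 0" "\<And>t. t > 0 \<Longrightarrow> t < d \<Longrightarrow> h' 0 < h' (0 + t)"
    using DERIV_pos_inc_right[OF h(2) \<open>c > 0\<close>] by blast
  define t where "t = min d e / 2"
  have t: "0 < t" "t < d" "t < e" using d e unfolding t_def by auto
  have "\<exists>z>0. z < t \<and> h t - h 0 = (t - 0) * h' z"
    by (rule MVT2) (use t e in \<open>auto simp: dist_real_def\<close>)
  then obtain z where z: "0 < z" "z < t" "h t - h 0 = t * h' z" by auto
  have "h' z > 0" using d(2)[of z] z t \<open>h' 0 = 0\<close> by auto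
  then have "h t > h 0" using z t by (smt (verit) mult_pos_pos)
  moreover have "h t \<le> h 0" using e(2)[of t] t by (auto simp: dist_real_def)
  ultimately show False by simp
qed

lemma eventually_line_in_open:
  fixes x v :: "'a :: real_normed_vector"
  assumes "open S" "x \<in> S"
  shows "\<forall>\<^sub>F t in nhds 0. x + t *\<^sub>R v \<in> S"
proof -
  have "((\<lambda>t. x + t *\<^sub>R v) \<longlongrightarrow> x + 0 *\<^sub>R v) (nhds 0)"
    by (intro tendsto_intros filterlim_ident)
  then show ?thesis
    using assms by (intro topological_tendstoD) auto
qed

lemma has_second_derivative_line:
  fixes u :: "real^2 \<Rightarrow> real"
  assumes "open S" "x \<in> S"
    and C2: "\<And>x. x \<in> S \<Longrightarrow> GDERIV u x :> Du x \<and> (Du has_derivative (\<lambda>h. D2u x *v h)) (at x)"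
  shows "has_second_derivative (\<lambda>t. u (x + t *\<^sub>R v)) ((D2u x *v v) \<bullet> v)"
proof (rule has_second_derivativeI)
  have line: "((\<lambda>t. x + t *\<^sub>R v) has_derivative (\<lambda>h. h *\<^sub>R v)) (at t)" for t
    by (auto intro!: derivative_eq_intros)
  show "\<forall>\<^sub>F t in nhds 0.
      ((\<lambda>t. u (x + t *\<^sub>R v)) has_real_derivative Du (x + t *\<^sub>R v) \<bullet> v) (at t)"
    using eventually_line_in_open[OF assms(1,2), of v]
  proof eventually_elim
    case (elim t)
    have "(u has_derivative (\<lambda>h. h \<bullet> Du (x + t *\<^sub>R v))) (at (x + t *\<^sub>R v))"
      using C2[OF elim] by (simp add: gderiv_def)
    from has_derivative_compose[OF line this]
    show ?case
      by (simp add: has_field_derivative_def inner_commute mult_commute_abs)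
  qed
  have "(Du has_derivative (\<lambda>h. D2u x *v h)) (at (x + 0 *\<^sub>R v))"
    using C2[OF assms(2)] by simp
  from has_derivative_compose[OF line this]
  have "((\<lambda>t. Du (x + t *\<^sub>R v) \<bullet> v) has_derivative (\<lambda>h. (D2u x *v (h *\<^sub>R v)) \<bullet> v)) (at 0)"
    by (rule has_derivative_inner_left)
  then show "((\<lambda>t. Du (x + t *\<^sub>R v) \<bullet> v) has_real_derivative (D2u x *v v) \<bullet> v) (at 0)"
    by (simp add: has_field_derivative_def matrix_vector_mult_scaleR mult_commute_abs)
qed

lemma has_second_derivative_norm_power2:
  fixes z v :: "'a :: real_inner"
  assumes "norm v = 1"
  shows "has_second_derivative (\<lambda>t. (norm (z + t *\<^sub>R v))\<^sup>2) 2"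
proof (rule has_second_derivativeI)
  have *: "(norm (z + t *\<^sub>R v))\<^sup>2 = (norm z)\<^sup>2 + 2 * t * (z \<bullet> v) + t\<^sup>2" for t
    using assms by (simp add: power2_norm_eq_inner algebra_simps inner_commute norm_eq_1)
       (simp add: power2_eq_square)
  show "\<forall>\<^sub>F t in nhds 0. ((\<lambda>t. (norm (z + t *\<^sub>R v))\<^sup>2) has_real_derivative 2 * (z \<bullet> v) + 2 * t) (at t)"
    unfolding * by (auto intro!: always_eventually derivative_eq_intros)
  show "((\<lambda>t. 2 * (z \<bullet> v) + 2 * t) has_real_derivative 2) (at 0)"
    by (auto intro!: derivative_eq_intros)
qed

lemma has_second_derivative_inverse_norm_power2:
  fixes z v :: "'a :: real_inner"
  assumes "norm v = 1" "z \<noteq> 0"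
  shows "has_second_derivative (\<lambda>t. 1 / (norm (z + t *\<^sub>R v))\<^sup>2)
           (8 * (z \<bullet> v)\<^sup>2 / norm z ^ 6 - 2 / norm z ^ 4)"
proof (rule has_second_derivativeI)
  define q where "q = (\<lambda>t. (norm z)\<^sup>2 + 2 * t * (z \<bullet> v) + t\<^sup>2)"
  have *: "(norm (z + t *\<^sub>R v))\<^sup>2 = q t" for t
    using assms by (simp add: q_def power2_norm_eq_inner algebra_simps inner_commute norm_eq_1)
       (simp add: power2_eq_square)
  have q': "(q has_real_derivative 2 * (z \<bullet> v) + 2 * t) (at t)" for t
    unfolding q_def by (auto intro!: derivative_eq_intros)
  have q0: "q 0 = (norm z)\<^sup>2" by (simp add: q_def)
  have "isCont q 0" using q' DERIV_isCont by blast
  then have "\<forall>\<^sub>F t in at 0. q t \<noteq> 0"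
    unfolding isCont_def by (rule tendsto_imp_eventually_ne) (use assms q0 in auto)
  then have "\<forall>\<^sub>F t in nhds 0. q t \<noteq> 0"
    using q0 assms by (auto simp: eventually_nhds_conv_at)
  then show "\<forall>\<^sub>F t in nhds 0. ((\<lambda>t. 1 / (norm (z + t *\<^sub>R v))\<^sup>2) has_real_derivative
      - (2 * (z \<bullet> v) + 2 * t) / (q t)\<^sup>2) (at t)"
    unfolding *
    by eventually_elim (auto intro!: derivative_eq_intros q' simp: power2_eq_square)
  show "((\<lambda>t. - (2 * (z \<bullet> v) + 2 * t) / (q t)\<^sup>2) has_real_derivative
      8 * (z \<bullet> v)\<^sup>2 / norm z ^ 6 - 2 / norm z ^ 4) (at 0)"
    using assms
    by (auto intro!: derivative_eq_intros q' simp: q0 field_simps power2_eq_square eval_nat_numeral)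
qed

definition rot :: "real^2 \<Rightarrow> real^2" where
  "rot e = vector [- (e$2), e$1]"

lemma rot_components [simp]: "rot e $ 1 = - (e$2)" "rot e $ 2 = e$1"
  by (simp_all add: rot_def)

lemma norm_rot [simp]: "norm (rot e) = norm e"
  by (simp add: norm_vec_def L2_set_def sum_2 add.commute)

lemma inner_rot_power2:
  assumes "norm e = 1"
  shows "(z \<bullet> e)\<^sup>2 + (z \<bullet> rot e)\<^sup>2 = (norm z)\<^sup>2"
proof -
  have "e$1 * e$1 + e$2 * e$2 = 1"
    using assms by (simp add: norm_eq_1 inner_vec_def sum_2)
  then have "(z$1 * z$1 + z$2 * z$2) * (e$1 * e$1 + e$2 * e$2) = z$1 * z$1 + z$2 * z$2"
    by simp
  moreover have "(norm z)\<^sup>2 = z$1 * z$1 + z$2 * z$2"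
    by (simp add: power2_norm_eq_inner inner_vec_def sum_2)
  ultimately show ?thesis
    by (simp add: inner_vec_def sum_2 power2_eq_square algebra_simps)
qed

lemma trace_eq_orthonormal:
  fixes A :: "real^2^2"
  assumes "norm e = 1"
  shows "(A *v e) \<bullet> e + (A *v rot e) \<bullet> rot e = trace A"
proof -
  have "e$1 * e$1 + e$2 * e$2 = 1"
    using assms by (simp add: norm_eq_1 inner_vec_def sum_2)
  then have "(A$1$1 + A$2$2) * (e$1 * e$1 + e$2 * e$2) = A$1$1 + A$2$2"
    by simp
  then show ?thesis
    by (simp add: trace_def inner_vec_def matrix_vector_mult_def sum_2 algebra_simps)
qed


lemma interior_closure_C2_boundary:
  assumes "open \<Omega>" "C2_boundary \<Omega>"
  shows "interior (closure \<Omega>) = \<Omega>"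
proof (rule antisym)
  show "interior (closure \<Omega>) \<subseteq> \<Omega>"
  proof (rule subsetI, rule ccontr)
    fix x assume x: "x \<in> interior (closure \<Omega>)" "x \<notin> \<Omega>"
    then have "x \<in> frontier \<Omega>"
      using interior_subset assms(1) by (auto simp: frontier_def interior_open)
    then obtain \<tau> n g where "below_C2_graph \<Omega> x \<tau> n g"
      using assms(2) unfolding C2_boundary_def by blast
    then obtain r where nt: "norm \<tau> = 1" "norm n = 1" "\<tau> \<bullet> n = 0" and "r > 0"
      and C2: "C2_real_on {-r<..<r} g"
      and below: "\<And>y. y \<in> ball x r \<Longrightarrow> y \<in> \<Omega> \<longleftrightarrow> (y - x) \<bullet> n < g ((y - x) \<bullet> \<tau>)"
      unfolding below_C2_graph_def by blast
    have g: "continuous_on {-r<..<r} g"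
      using C2 unfolding C2_real_on_def
      by (meson DERIV_isCont continuous_at_imp_continuous_on)
    have g0: "g 0 \<le> 0"
      using below[of x] x(2) \<open>r > 0\<close> by simp
    have sub: "(\<lambda>y. (y - x) \<bullet> \<tau>) ` ball x r \<subseteq> {-r<..<r}"
    proof safe
      fix y assume "y \<in> ball x r"
      moreover have "\<bar>(y - x) \<bullet> \<tau>\<bar> \<le> norm (y - x)"
        using Cauchy_Schwarz_ineq2[of "y - x" \<tau>] nt by simp
      ultimately show "(y - x) \<bullet> \<tau> \<in> {-r<..<r}"
        by (auto simp: dist_norm norm_minus_commute)
    qed
    define G where "G = (\<lambda>y. g ((y - x) \<bullet> \<tau>) - (y - x) \<bullet> n)"
    have "continuous_on (ball x r) G"
      unfolding G_def
      by (intro continuous_intros continuous_on_compose2[OF g _ sub])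
    then have "open (ball x r \<inter> G -` {..<0})"
      by (intro continuous_open_preimage) auto
    moreover have "(ball x r \<inter> G -` {..<0}) \<inter> \<Omega> = {}"
      using below by (auto simp: G_def)
    ultimately have disj: "(ball x r \<inter> G -` {..<0}) \<inter> closure \<Omega> = {}"
      by (simp add: open_Int_closure_eq_empty)
    have "open (ball x r \<inter> interior (closure \<Omega>))" "x \<in> ball x r \<inter> interior (closure \<Omega>)"
      using x \<open>r > 0\<close> by auto
    from eventually_line_in_open[OF this, of n]
    obtain e where e: "e > 0"
      "\<And>t. dist t 0 < e \<Longrightarrow> x + t *\<^sub>R n \<in> ball x r \<inter> interior (closure \<Omega>)"
      unfolding eventually_nhds_metric by blast
    have y: "x + (e/2) *\<^sub>R n \<in> ball x r \<inter> interior (closure \<Omega>)"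
      by (rule e) (use e in auto)
    have "G (x + (e/2) *\<^sub>R n) < 0"
      using nt g0 e by (simp add: G_def inner_commute norm_eq_1)
    then show False
      using y disj interior_subset by fastforce
  qed
  show "\<Omega> \<subseteq> interior (closure \<Omega>)"
    by (intro interior_maximal closure_subset assms(1))
qed

lemma has_second_derivative_cos: "has_second_derivative (\<lambda>t. cos (p + a * t)) (- a\<^sup>2 * cos p)"
proof (rule has_second_derivativeI)
  show "\<forall>\<^sub>F t in nhds 0. ((\<lambda>t. cos (p + a * t)) has_real_derivative - a * sin (p + a * t)) (at t)"
    by (auto intro!: always_eventually derivative_eq_intros)
  show "((\<lambda>t. - a * sin (p + a * t)) has_real_derivative - a\<^sup>2 * cos p) (at 0)"
    by (auto intro!: derivative_eq_intros simp: power2_eq_square)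
qed

lemma abs_less_pi_half_if_cos_pos:
  assumes "\<bar>x\<bar> \<le> pi / 2" "cos x > 0"
  shows "\<bar>x\<bar> < pi / 2"
  using assms cos_pi_half cos_abs_real[of x] by (cases "\<bar>x\<bar> = pi / 2") auto

lemma positive_supersolution_no_large_ball:
  fixes u :: "real^2 \<Rightarrow> real"
  assumes S: "open S"
    and C2: "\<And>x. x \<in> S \<Longrightarrow> GDERIV u x :> Du x \<and> (Du has_derivative (\<lambda>h. D2u x *v h)) (at x)"
    and pos: "\<And>x. x \<in> S \<Longrightarrow> u x > 0"
    and super: "\<And>x. x \<in> S \<Longrightarrow> trace (D2u x) + l * u x \<le> 0"
    and l: "l > 0"
  shows "\<not> ball c (3 * pi / sqrt l) \<subseteq> S"
proof
  assume sub: "ball c (3 * pi / sqrt l) \<subseteq> S"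
  define a where "a = sqrt l / 2"
  define b where "b = pi / sqrt l"
  have ab: "a > 0" "b > 0" "a * b = pi / 2" "2 * a\<^sup>2 < l"
    using l by (auto simp: a_def b_def power_divide)
  define K where "K = cbox (c - vec b) (c + vec b)"
  have K: "y \<in> K \<longleftrightarrow> \<bar>y$1 - c$1\<bar> \<le> b \<and> \<bar>y$2 - c$2\<bar> \<le> b" for y
    by (auto simp: K_def mem_box_cart forall_2)
  have K_sub: "K \<subseteq> S"
  proof
    fix y assume "y \<in> K"
    have "norm (y - c) \<le> \<bar>y$1 - c$1\<bar> + \<bar>y$2 - c$2\<bar>"
      using norm_le_l1_cart[of "y - c"] by (simp add: sum_2)
    also have "\<dots> < 3 * b" using \<open>y \<in> K\<close> ab by (simp add: K)
    finally show "y \<in> S"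
      using sub by (auto simp: b_def dist_norm norm_minus_commute subset_iff)
  qed
  define \<psi> where "\<psi> = (\<lambda>y::real^2. cos (a * (y$1 - c$1)) * cos (a * (y$2 - c$2)))"
  have "continuous_on S u"
    using C2 by (meson GDERIV_DERIV_compose continuous_at_imp_continuous_on gderiv_def
        has_derivative_continuous)
  then have "continuous_on K (\<lambda>y. \<psi> y / u y)"
    unfolding \<psi>_def using K_sub pos
    by (intro continuous_intros) (force intro: continuous_on_subset)+
  moreover have "c \<in> K" using ab by (simp add: K)
  moreover have "compact K" by (simp add: K_def)
  ultimately obtain x where x: "x \<in> K" and max: "\<And>y. y \<in> K \<Longrightarrow> \<psi> y / u y \<le> \<psi> x / u x"
    using continuous_attains_sup[of K "\<lambda>y. \<psi> y / u y"] by blast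
  have ux: "u x > 0" and xS: "x \<in> S" using x K_sub pos by auto
  define k where "k = \<psi> x / u x"
  have "k > 0"
  proof -
    have "0 < \<psi> c / u c"
      using \<open>c \<in> K\<close> K_sub pos by (auto simp: \<psi>_def)
    then show ?thesis using max[OF \<open>c \<in> K\<close>] by (simp add: k_def)
  qed
  have \<psi>x: "\<psi> x = k * u x" "\<psi> x > 0"
    using ux \<open>k > 0\<close> by (auto simp: k_def field_simps zero_less_divide_iff)
  have le: "\<bar>a * (x$1 - c$1)\<bar> \<le> pi / 2" "\<bar>a * (x$2 - c$2)\<bar> \<le> pi / 2"
    using x ab by (auto simp: K abs_mult simp flip: ab(3))
  then have "cos (a * (x$1 - c$1)) \<ge> 0" "cos (a * (x$2 - c$2)) \<ge> 0"
    by (auto intro!: cos_ge_zero simp: abs_le_iff)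
  then have "cos (a * (x$1 - c$1)) > 0" "cos (a * (x$2 - c$2)) > 0"
    using \<psi>x(2) by (auto simp: \<psi>_def zero_less_mult_iff)
  then have "\<bar>a * (x$1 - c$1)\<bar> < a * b" "\<bar>a * (x$2 - c$2)\<bar> < a * b"
    using le abs_less_pi_half_if_cos_pos unfolding ab(3) by blast+
  then have "\<bar>x$1 - c$1\<bar> < b" "\<bar>x$2 - c$2\<bar> < b"
    using ab(1) by (simp_all add: abs_mult)
  then have "x \<in> box (c - vec b) (c + vec b)"
    by (auto simp: mem_box_cart forall_2)
  then have ev: "\<forall>\<^sub>F t in nhds 0. x + t *\<^sub>R v \<in> K" for v
    using eventually_line_in_open[OF open_box] box_subset_cbox
    unfolding K_def by (fast elim: eventually_mono)
  have "- a\<^sup>2 * \<psi> x - k * ((D2u x *v v) \<bullet> v) \<le> 0"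
    if "has_second_derivative (\<lambda>t. \<psi> (x + t *\<^sub>R v)) (- a\<^sup>2 * \<psi> x)" for v
  proof (rule has_second_derivative_local_max)
    show "has_second_derivative (\<lambda>t. \<psi> (x + t *\<^sub>R v) - k * u (x + t *\<^sub>R v))
      (- a\<^sup>2 * \<psi> x - k * ((D2u x *v v) \<bullet> v))"
      by (intro has_second_derivative_diff that has_second_derivative_cmult
          has_second_derivative_line[OF S xS C2])
    show "\<forall>\<^sub>F t in nhds 0. \<psi> (x + t *\<^sub>R v) - k * u (x + t *\<^sub>R v)
        \<le> \<psi> (x + 0 *\<^sub>R v) - k * u (x + 0 *\<^sub>R v)"
      using ev[of v]
    proof eventually_elim
      case (elim t)
      have "u (x + t *\<^sub>R v) > 0" using elim K_sub pos by auto
      moreover have "\<psi> (x + t *\<^sub>R v) / u (x + t *\<^sub>R v) \<le> k"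
        using max[OF elim] by (simp add: k_def)
      ultimately show ?case
        using \<psi>x by (simp add: pos_divide_le_eq)
    qed
  qed
  note second = this
  define e :: "real^2" where "e = axis 1 1"
  have e: "e$1 = 1" "e$2 = 0" "norm e = 1"
    unfolding e_def by (simp_all add: norm_axis_1) (simp_all add: axis_def)
  have "has_second_derivative (\<lambda>t. cos (a * (x$2 - c$2)) * cos (a * (x$1 - c$1) + a * t))
      (cos (a * (x$2 - c$2)) * (- a\<^sup>2 * cos (a * (x$1 - c$1))))"
    by (intro has_second_derivative_cmult has_second_derivative_cos)
  then have 1: "- a\<^sup>2 * \<psi> x - k * ((D2u x *v e) \<bullet> e) \<le> 0"
    by (intro second) (simp add: \<psi>_def e algebra_simps)
  have "has_second_derivative (\<lambda>t. cos (a * (x$1 - c$1)) * cos (a * (x$2 - c$2) + a * t))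
      (cos (a * (x$1 - c$1)) * (- a\<^sup>2 * cos (a * (x$2 - c$2))))"
    by (intro has_second_derivative_cmult has_second_derivative_cos)
  then have 2: "- a\<^sup>2 * \<psi> x - k * ((D2u x *v rot e) \<bullet> rot e) \<le> 0"
    by (intro second) (simp add: \<psi>_def e algebra_simps)
  have "- (2 * a\<^sup>2) * \<psi> x \<le> k * trace (D2u x)"
    using 1 2 trace_eq_orthonormal[OF e(3), of "D2u x", symmetric] by (simp add: algebra_simps)
  also have "\<dots> \<le> k * (- l * u x)"
    using super[OF xS] \<open>k > 0\<close> by (intro mult_left_mono) auto
  finally have "l * \<psi> x \<le> 2 * a\<^sup>2 * \<psi> x"
    by (simp add: \<psi>x algebra_simps)
  then show False using ab \<psi>x by (simp add: mult_le_cancel_right)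
qed


lemma superharmonic_lower_Lipschitz_at_center:
  fixes u :: "real^2 \<Rightarrow> real"
  assumes S: "open S"
    and C2: "\<And>x. x \<in> S \<Longrightarrow> GDERIV u x :> Du x \<and> (Du has_derivative (\<lambda>h. D2u x *v h)) (at x)"
    and s: "s > 0" "cball x1 s \<subseteq> S"
    and N: "N > 0" "\<And>x. x \<in> cball x1 s \<Longrightarrow> 0 \<le> u x \<and> u x \<le> N"
    and F: "F \<ge> 0" "\<And>x. x \<in> cball x1 s \<Longrightarrow> - F \<le> trace (D2u x) \<and> trace (D2u x) \<le> 0"
    and y1: "y1 \<in> cball x1 (s/2)"
  shows "u x1 - u y1 \<le> (4 * N / s + s * F / 8) * norm (x1 - y1)"
proof -
  define K where "K = 4 * N / s\<^sup>2"
  define B where "B = (F + 4 * K) / 4"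
  define A where "A = 4 * N / s + s * F / 8"
  have K: "K > 0" "K * (s/2)\<^sup>2 = N" using s N by (auto simp: K_def power_divide)
  have B: "B > 0" using K F by (simp add: B_def)
  have AB: "A - B * (s/2) = 2 * N / s"
    using s by (simp add: A_def B_def K_def field_simps power2_eq_square)
  define \<phi> where "\<phi> = (\<lambda>r. A * r - B * r\<^sup>2)"
  have \<phi>_nonneg: "0 \<le> \<phi> r" if "0 \<le> r" "r \<le> s/2" for r
  proof -
    have "B * r \<le> B * (s/2)" using that B by (intro mult_left_mono) auto
    then have "B * r \<le> A" using AB N s by (smt (verit) divide_pos_pos)
    then have "0 \<le> r * (A - B * r)" using that by (intro mult_nonneg_nonneg) auto
    then show ?thesis by (simp add: \<phi>_def algebra_simps power2_eq_square)
  qed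
  have \<phi>_end: "\<phi> (s/2) = N"
  proof -
    have "\<phi> (s/2) = s/2 * (A - B * (s/2))" by (simp add: \<phi>_def algebra_simps power2_eq_square)
    also have "\<dots> = N" unfolding AB using s by simp
    finally show ?thesis .
  qed
  define W where "W = (\<lambda>(x, z). u x - u (x - z) - \<phi> (norm z) - K * (norm (x - x1 :: real^2))\<^sup>2)"
  define P where "P = cball x1 (s/2) \<times> cball (0 :: real^2) (s/2)"
  have P_sub: "x \<in> cball x1 s" "x - z \<in> cball x1 s" if "(x, z) \<in> P" for x z
  proof -
    have "norm (x - x1) \<le> s/2" "norm z \<le> s/2"
      using that by (auto simp: P_def dist_norm norm_minus_commute)
    moreover have "norm (x - z - x1) \<le> norm (x - x1) + norm z"
      using norm_triangle_ineq4[of "x - x1" z] by (simp add: algebra_simps)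
    ultimately show "x \<in> cball x1 s" "x - z \<in> cball x1 s"
      using s by (auto simp: dist_norm norm_minus_commute[of x1])
  qed
  have "continuous_on S u"
    using C2 by (meson continuous_at_imp_continuous_on gderiv_def has_derivative_continuous)
  then have "continuous_on (cball x1 s) u"
    using s(2) continuous_on_subset by blast
  then have "continuous_on P (\<lambda>q. u (fst q))" "continuous_on P (\<lambda>q. u (fst q - snd q))"
    by (rule continuous_on_compose2; use P_sub in \<open>auto intro!: continuous_intros simp del: mem_cball\<close>)+
  then have "continuous_on P W"
    unfolding W_def \<phi>_def split_beta by (intro continuous_intros)
  moreover have "compact P" "(x1, 0) \<in> P" using s by (auto simp: P_def compact_Times)
  ultimately obtain m where "m \<in> P" and "\<And>q. q \<in> P \<Longrightarrow> W q \<le> W m"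
    using continuous_attains_sup[of P W] by blast
  then obtain x z where xz: "(x, z) \<in> P" and max: "\<And>q. q \<in> P \<Longrightarrow> W q \<le> W (x, z)"
    by (cases m) auto
  have "W (x, z) \<le> 0"
  proof (rule ccontr)
    assume "\<not> W (x, z) \<le> 0"
    then have W_pos: "W (x, z) > 0" by simp
    define y where "y = x - z"
    define r where "r = norm z"
    have norms: "norm (x - x1) \<le> s/2" "0 \<le> r" "r \<le> s/2"
      using xz by (auto simp: P_def r_def dist_norm norm_minus_commute)
    have cb: "x \<in> cball x1 s" "y \<in> cball x1 s" using P_sub[OF xz] by (auto simp: y_def)
    then have xy: "x \<in> S" "y \<in> S" using s by auto
    have W_eq: "W (x, z) = u x - u y - \<phi> r - K * (norm (x - x1))\<^sup>2"
      by (simp add: W_def y_def r_def)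
    have "r \<noteq> 0"
    proof
      assume "r = 0"
      then have "y = x" by (simp add: r_def y_def)
      then have "W (x, z) = - (K * (norm (x - x1))\<^sup>2)" using \<open>r = 0\<close> by (simp add: W_eq \<phi>_def)
      moreover have "K * (norm (x - x1))\<^sup>2 \<ge> 0" using K by simp
      ultimately show False using W_pos by linarith
    qed
    have "r \<noteq> s/2"
    proof
      assume "r = s/2"
      then have "\<phi> r = N" using \<phi>_end by (simp only:)
      moreover have "K * (norm (x - x1))\<^sup>2 \<ge> 0" using K by simp
      ultimately show False
        using W_pos N(2)[OF cb(1)] N(2)[OF cb(2)] by (simp add: W_eq)
    qed
    have "norm (x - x1) \<noteq> s/2"
    proof
      assume "norm (x - x1) = s/2"
      then have "K * (norm (x - x1))\<^sup>2 = N" using K(2) by (simp only:)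
      then show False
        using W_pos N(2)[OF cb(1)] N(2)[OF cb(2)] \<phi>_nonneg[of r] norms by (simp add: W_eq)
    qed
    have r: "0 < r" "r < s/2" and x: "norm (x - x1) < s/2"
      using norms \<open>r \<noteq> 0\<close> \<open>r \<noteq> s/2\<close> \<open>norm (x - x1) \<noteq> s/2\<close> by auto
    define e where "e = z /\<^sub>R r"
    have e: "norm e = 1" "z = r *\<^sub>R e" using r by (auto simp: e_def r_def)
    have ev_x: "\<forall>\<^sub>F t in nhds 0. x + t *\<^sub>R v \<in> ball x1 (s/2)" for v
      by (rule eventually_line_in_open) (use x in \<open>auto simp: dist_norm norm_minus_commute\<close>)
    have ev_z: "\<forall>\<^sub>F t in nhds 0. z + t *\<^sub>R v \<in> ball 0 (s/2) - {0}" for v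
      by (rule eventually_line_in_open) (use r in \<open>auto simp: r_def\<close>)
    note line = has_second_derivative_line[OF S _ C2]
    text \<open>Moving the two points towards or away from each other along the line joining them:
      here the distance varies affinely.\<close>
    have "(D2u x *v e) \<bullet> e - (D2u y *v (- e)) \<bullet> (- e) - (- 8 * B) - K * 2 \<le> 0"
    proof (rule has_second_derivative_local_max)
      define h where "h = (\<lambda>t. u (x + t *\<^sub>R e) - u (y + t *\<^sub>R (- e)) - \<phi> (r + 2 * t)
          - K * (norm ((x - x1) + t *\<^sub>R e))\<^sup>2)"
      have "has_second_derivative (\<lambda>t. \<phi> (r + 2 * t)) (- 8 * B)"
      proof (rule has_second_derivativeI)
        show "\<forall>\<^sub>F t in nhds 0.
            ((\<lambda>t. \<phi> (r + 2 * t)) has_real_derivative 2 * A - 4 * B * (r + 2 * t)) (at t)"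
          unfolding \<phi>_def
          by (auto intro!: always_eventually derivative_eq_intros simp: algebra_simps)
        show "((\<lambda>t. 2 * A - 4 * B * (r + 2 * t)) has_real_derivative - 8 * B) (at 0)"
          by (auto intro!: derivative_eq_intros)
      qed
      then show "has_second_derivative h
          ((D2u x *v e) \<bullet> e - (D2u y *v (- e)) \<bullet> (- e) - (- 8 * B) - K * 2)"
        unfolding h_def
        by (intro has_second_derivative_diff has_second_derivative_cmult line xy
            has_second_derivative_norm_power2 e)
      have "\<forall>\<^sub>F t in nhds 0. 0 + t *\<^sub>R 1 \<in> {- r / 2<..}"
        by (rule eventually_line_in_open) (use r in auto)
      then show "\<forall>\<^sub>F t in nhds 0. h t \<le> h 0"
        using ev_x[of e] ev_z[of "2 *\<^sub>R e"]
      proof eventually_elim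
        case (elim t)
        have "z + t *\<^sub>R (2 *\<^sub>R e) = (r + 2 * t) *\<^sub>R e" by (simp add: e(2) algebra_simps)
        then have n: "norm (z + t *\<^sub>R (2 *\<^sub>R e)) = r + 2 * t" using e(1) elim by simp
        have d: "x + t *\<^sub>R e - (z + t *\<^sub>R (2 *\<^sub>R e)) = y + t *\<^sub>R (- e)"
          by (simp add: y_def algebra_simps flip: scaleR_2)
        have "(x + t *\<^sub>R e, z + t *\<^sub>R (2 *\<^sub>R e)) \<in> P"
          using elim(2,3) by (auto simp: P_def simp del: scaleR_scaleR)
        from max[OF this] show ?case
          unfolding W_eq unfolding W_def prod.case n d by (simp add: h_def algebra_simps)
      qed
    qed
    then have 1: "(D2u x *v e) \<bullet> e - (D2u y *v e) \<bullet> e + 8 * B - 2 * K \<le> 0"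
      using matrix_vector_mult_scaleR[of "D2u y" "-1" e] by simp
    have 2: "(D2u x *v rot e) \<bullet> rot e - (D2u y *v rot e) \<bullet> rot e - K * 2 \<le> 0"
    proof (rule has_second_derivative_local_max)
      define h where "h = (\<lambda>t. u (x + t *\<^sub>R rot e) - u (y + t *\<^sub>R rot e)
          - K * (norm ((x - x1) + t *\<^sub>R rot e))\<^sup>2)"
      show "has_second_derivative h
          ((D2u x *v rot e) \<bullet> rot e - (D2u y *v rot e) \<bullet> rot e - K * 2)"
        unfolding h_def
        by (intro has_second_derivative_diff has_second_derivative_cmult line xy
            has_second_derivative_norm_power2) (simp_all add: e(1))
      show "\<forall>\<^sub>F t in nhds 0. h t \<le> h 0"
        using ev_x[of "rot e"]
      proof eventually_elim
        case (elim t)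
        have d: "x + t *\<^sub>R rot e - z = y + t *\<^sub>R rot e" by (simp add: y_def)
        have "(x + t *\<^sub>R rot e, z) \<in> P"
          using elim xz by (auto simp: P_def)
        from max[OF this] show ?case
          unfolding W_eq unfolding W_def prod.case r_def[symmetric] d
          by (simp add: h_def algebra_simps)
      qed
    qed
    have B8: "8 * B = 2 * F + 8 * K" by (simp add: B_def)
    have "trace (D2u x) - trace (D2u y) + 8 * B - 4 * K \<le> 0"
      using 1 2 by (simp flip: trace_eq_orthonormal[OF e(1)])
    then show False
      using F(1) conjunct1[OF F(2)[OF cb(1)]] conjunct2[OF F(2)[OF cb(2)]] K(1) B8
      by linarith
  qed
  moreover have "(x1, x1 - y1) \<in> P"
    using y1 s by (auto simp: P_def dist_norm norm_minus_commute)
  ultimately have "u x1 - u y1 - \<phi> (norm (x1 - y1)) \<le> 0"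
    using max[of "(x1, x1 - y1)"] by (simp add: W_def)
  moreover have "\<phi> (norm (x1 - y1)) \<le> A * norm (x1 - y1)"
    using B by (simp add: \<phi>_def)
  ultimately show ?thesis unfolding A_def by linarith
qed

lemma superharmonic_annulus_lower_bound:
  fixes u :: "real^2 \<Rightarrow> real"
  assumes S: "open S"
    and C2: "\<And>x. x \<in> S \<Longrightarrow> GDERIV u x :> Du x \<and> (Du has_derivative (\<lambda>h. D2u x *v h)) (at x)"
    and cont: "continuous_on (cball x1 d) u"
    and d: "ball x1 d \<subseteq> S" "0 < \<rho>"
    and super: "\<And>x. x \<in> ball x1 d \<Longrightarrow> trace (D2u x) \<le> 0"
    and nonneg: "\<And>x. x \<in> cball x1 d \<Longrightarrow> u x \<ge> 0"
    and m: "0 < m" "\<And>x. x \<in> sphere x1 \<rho> \<Longrightarrow> m \<le> u x"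
    and y: "y \<in> cball x1 d - ball x1 \<rho>"
  shows "m * \<rho>\<^sup>2 * (1 / (norm (y - x1))\<^sup>2 - 1 / d\<^sup>2) \<le> u y"
proof -
  define c where "c = m * \<rho>\<^sup>2"
  have "c > 0" using m d by (simp add: c_def)
  define G where "G = (\<lambda>x. c * (1 / (norm (x - x1))\<^sup>2 - 1 / d\<^sup>2) - u x)"
  have "continuous_on (cball x1 d - ball x1 \<rho>) G"
    unfolding G_def
    by (intro continuous_intros continuous_on_subset[OF cont]) (use d in auto)
  moreover have "compact (cball x1 d - ball x1 \<rho>)"
    by (intro compact_diff) auto
  ultimately obtain x where x: "x \<in> cball x1 d - ball x1 \<rho>"
    and max: "\<And>z. z \<in> cball x1 d - ball x1 \<rho> \<Longrightarrow> G z \<le> G x"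
    using continuous_attains_sup[of "cball x1 d - ball x1 \<rho>" G] y by (metis empty_iff)
  have "G x \<le> 0"
  proof (rule ccontr)
    assume "\<not> G x \<le> 0"
    then have Gx: "G x > 0" by simp
    have "norm (x - x1) \<noteq> d"
      using Gx nonneg[of x] x by (auto simp: G_def)
    moreover have "norm (x - x1) \<noteq> \<rho>"
    proof
      assume *: "norm (x - x1) = \<rho>"
      then have "m \<le> u x" by (intro m) (auto simp: dist_norm norm_minus_commute)
      moreover have "G x = m - c / d\<^sup>2 - u x"
        using d by (simp add: G_def * right_diff_distrib c_def)
      moreover have "c / d\<^sup>2 \<ge> 0" using \<open>c > 0\<close> by simp
      ultimately show False using Gx by linarith
    qed
    ultimately have xU: "x \<in> ball x1 d - cball x1 \<rho>"
      using x by (auto simp: dist_norm norm_minus_commute)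
    define z where "z = x - x1"
    have "z \<noteq> 0" using xU d by (auto simp: z_def)
    have xS: "x \<in> S" using xU d by auto
    have "c * (8 * (z \<bullet> v)\<^sup>2 / norm z ^ 6 - 2 / norm z ^ 4 - 0) - (D2u x *v v) \<bullet> v \<le> 0"
      if "norm v = 1" for v
    proof (rule has_second_derivative_local_max)
      have "has_second_derivative (\<lambda>t. 1 / d\<^sup>2) 0"
        by (rule has_second_derivativeI[of _ "\<lambda>_. 0"]) auto
      then show "has_second_derivative
          (\<lambda>t. c * (1 / (norm (z + t *\<^sub>R v))\<^sup>2 - 1 / d\<^sup>2) - u (x + t *\<^sub>R v))
          (c * (8 * (z \<bullet> v)\<^sup>2 / norm z ^ 6 - 2 / norm z ^ 4 - 0) - (D2u x *v v) \<bullet> v)"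
        by (intro has_second_derivative_diff has_second_derivative_cmult
            has_second_derivative_inverse_norm_power2 that \<open>z \<noteq> 0\<close>
            has_second_derivative_line[OF S xS C2])
      have "\<forall>\<^sub>F t in nhds 0. x + t *\<^sub>R v \<in> ball x1 d - cball x1 \<rho>"
        using xU by (intro eventually_line_in_open) auto
      then show "\<forall>\<^sub>F t in nhds 0. c * (1 / (norm (z + t *\<^sub>R v))\<^sup>2 - 1 / d\<^sup>2) - u (x + t *\<^sub>R v)
          \<le> c * (1 / (norm (z + 0 *\<^sub>R v))\<^sup>2 - 1 / d\<^sup>2) - u (x + 0 *\<^sub>R v)"
      proof eventually_elim
        case (elim t)
        then show ?case
          using max[of "x + t *\<^sub>R v"] by (simp add: G_def z_def algebra_simps)
      qed
    qed
    note second = this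
    define e :: "real^2" where "e = axis 1 1"
    have e: "norm e = 1" by (simp add: e_def norm_axis_1)
    have "c * (8 * ((z \<bullet> e)\<^sup>2 + (z \<bullet> rot e)\<^sup>2) / norm z ^ 6 - 4 / norm z ^ 4) - trace (D2u x) \<le> 0"
      using second[of e] second[of "rot e"] e
      by (simp add: divide_inverse algebra_simps flip: trace_eq_orthonormal[OF e])
    moreover have "8 * (norm z)\<^sup>2 / norm z ^ 6 - 4 / norm z ^ 4 = 4 / norm z ^ 4"
      using \<open>z \<noteq> 0\<close> by (simp add: field_simps eval_nat_numeral)
    ultimately have "c * (4 / norm z ^ 4) \<le> trace (D2u x)"
      by (simp add: inner_rot_power2[OF e])
    moreover have "c * (4 / norm z ^ 4) > 0" using \<open>c > 0\<close> \<open>z \<noteq> 0\<close> by simp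
    ultimately show False using super[of x] xU by auto
  qed
  then have "G y \<le> 0" using max[OF y] by simp
  then show ?thesis by (simp add: G_def c_def)
qed


lemma interior_ball_touching_frontier:
  fixes x :: "'a :: euclidean_space"
  assumes "open S" "x \<in> S" "S \<noteq> UNIV"
  obtains p where "p \<in> frontier S" "ball x (dist x p) \<subseteq> S"
proof -
  have "closed (- S)" "- S \<noteq> {}" using assms by auto
  then obtain p where p: "p \<in> - S" "\<And>y. y \<in> - S \<Longrightarrow> dist x p \<le> dist x y"
    using distance_attains_inf[of "- S" x] by blast
  have sub: "ball x (dist x p) \<subseteq> S"
    using p(2) by force
  have "dist x p > 0" using p(1) assms(2) by auto
  then have "p \<in> closure (ball x (dist x p))" by simp
  then have "p \<in> frontier S"
    using closure_mono[OF sub] p(1) interior_subset[of S] by (auto simp: frontier_def simp del: closure_ball)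
  then show ?thesis using sub by (rule that)
qed

lemma outward_normal_of_interior_ball:
  assumes graph: "below_C2_graph \<Omega> p \<tau> n g"
    and p: "p \<notin> \<Omega>" and ball: "ball x d \<subseteq> \<Omega>" "d > 0" and e: "norm e = 1" "p = x + d *\<^sub>R e"
  shows "outward_unit_normal \<Omega> p e"
proof -
  obtain r where nt: "norm \<tau> = 1" "norm n = 1" "\<tau> \<bullet> n = 0" and "r > 0"
    and C2: "C2_real_on {-r<..<r} g"
    and below: "\<And>y. y \<in> ball p r \<Longrightarrow> y \<in> \<Omega> \<longleftrightarrow> (y - p) \<bullet> n < g ((y - p) \<bullet> \<tau>)"
    using graph unfolding below_C2_graph_def by blast
  obtain a where a: "(g has_real_derivative a) (at 0)"
    using C2 \<open>r > 0\<close> unfolding C2_real_on_def by force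
  have g0: "g 0 \<le> 0" using below[of p] p \<open>r > 0\<close> by simp
  define m where "m = n - a *\<^sub>R \<tau>"
  have "m \<bullet> n = 1" using nt by (simp add: m_def inner_diff_left norm_eq_1)
  then have "m \<noteq> 0" by auto
  have half_plane: "w \<bullet> m \<le> 0" if w: "w \<bullet> e < 0" for w
  proof (rule ccontr)
    assume "\<not> w \<bullet> m \<le> 0"
    define k where "k = (\<lambda>t. g (t * (w \<bullet> \<tau>)) - t * (w \<bullet> n))"
    have "((\<lambda>t. g (t * (w \<bullet> \<tau>))) has_real_derivative a * (w \<bullet> \<tau>)) (at 0)"
      using a by (intro DERIV_chain2[where g = "\<lambda>t. t * (w \<bullet> \<tau>)" and f = g])
         (auto intro!: derivative_eq_intros)
    then have "(k has_real_derivative - (w \<bullet> m)) (at 0)"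
      unfolding k_def m_def
      by (auto intro!: derivative_eq_intros simp: inner_diff_right)
    then obtain \<delta> where \<delta>: "\<delta> > 0" "\<And>t. 0 < t \<Longrightarrow> t < \<delta> \<Longrightarrow> k t < k 0"
      using DERIV_neg_dec_right[of k "- (w \<bullet> m)" 0] \<open>\<not> w \<bullet> m \<le> 0\<close> by auto
    have "\<forall>\<^sub>F t in nhds 0. p + t *\<^sub>R w \<in> ball p r"
      by (rule eventually_line_in_open) (use \<open>r > 0\<close> in auto)
    then obtain \<epsilon> where \<epsilon>: "\<epsilon> > 0" "\<And>t. dist t 0 < \<epsilon> \<Longrightarrow> p + t *\<^sub>R w \<in> ball p r"
      unfolding eventually_nhds_metric by blast
    define D where "D = (norm w)\<^sup>2 + 1"
    have "D > 0" by (simp add: D_def add_nonneg_pos)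
    define c where "c = - 2 * d * (w \<bullet> e) / D"
    have "c > 0" using w \<open>d > 0\<close> \<open>D > 0\<close>
      by (auto simp: c_def mult_pos_neg intro!: divide_neg_pos)
    define t where "t = min (min \<delta> \<epsilon>) c / 2"
    have t: "0 < t" "t < \<delta>" "t < \<epsilon>" "t < c" using \<delta> \<epsilon> \<open>c > 0\<close> by (auto simp: t_def)
    have "t * D < c * D" using t(4) \<open>D > 0\<close> by simp
    also have "c * D = - 2 * d * (w \<bullet> e)" using \<open>D > 0\<close> by (simp add: c_def)
    finally have "t * (norm w)\<^sup>2 + 2 * d * (w \<bullet> e) < 0"
      using t(1) by (simp add: D_def algebra_simps)
    then have "t * (t * (norm w)\<^sup>2 + 2 * d * (w \<bullet> e)) < 0" using t(1) by (simp add: mult_pos_neg)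
    moreover have "(norm (d *\<^sub>R e + t *\<^sub>R w))\<^sup>2 = d\<^sup>2 + t * (t * (norm w)\<^sup>2 + 2 * d * (w \<bullet> e))"
      using e(1) by (simp add: power2_norm_eq_inner norm_eq_1 algebra_simps inner_commute)
         (simp add: power2_eq_square)
    ultimately have "(norm (d *\<^sub>R e + t *\<^sub>R w))\<^sup>2 < d\<^sup>2" by simp
    then have "norm (d *\<^sub>R e + t *\<^sub>R w) < d"
      using \<open>d > 0\<close> by (meson less_imp_le power_less_imp_less_base)
    then have "p + t *\<^sub>R w \<in> ball x d"
      by (simp add: e dist_commute[of x]) (simp add: dist_norm)
    then have "p + t *\<^sub>R w \<in> \<Omega>" using ball by auto
    then have "k t > 0"
      using below[of "p + t *\<^sub>R w"] \<epsilon>(2)[of t] t by (simp add: k_def dist_real_def)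
    then show False using \<delta>(2)[of t] t g0 by (simp add: k_def)
  qed
  have "sgn m = e"
  proof (rule ccontr)
    assume "sgn m \<noteq> e"
    have unit: "norm (sgn m) = 1" "m = norm m *\<^sub>R sgn m"
      using \<open>m \<noteq> 0\<close> by (auto simp: norm_sgn sgn_div_norm)
    have "(norm (sgn m - e))\<^sup>2 = 2 - 2 * (sgn m \<bullet> e)"
      using unit(1) e(1) by (simp add: power2_norm_eq_inner norm_eq_1 algebra_simps inner_commute)
    moreover have "(norm (sgn m - e))\<^sup>2 > 0" using \<open>sgn m \<noteq> e\<close> by simp
    ultimately have lt: "sgn m \<bullet> e < 1" by simp
    then have "(sgn m - e) \<bullet> e < 0" using e(1) by (simp add: inner_diff_left norm_eq_1)
    from half_plane[OF this] have "(sgn m - e) \<bullet> (norm m *\<^sub>R sgn m) \<le> 0" using unit(2) by simp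
    then have "norm m * (1 - sgn m \<bullet> e) \<le> 0"
      using unit(1) by (simp add: inner_diff_left inner_diff_right norm_eq_1 inner_commute)
    then show False using lt \<open>m \<noteq> 0\<close> by (simp add: mult_le_0_iff)
  qed
  then show ?thesis
    unfolding outward_unit_normal_def using graph DERIV_imp_deriv[OF a] m_def by blast
qed

lemma boundary_slope_of_annulus_lower_bound:
  fixes u :: "real^2 \<Rightarrow> real"
  assumes gderiv: "\<And>x. x \<in> S \<Longrightarrow> GDERIV u x :> Du x"
    and cont: "continuous_on (closure S) u" "continuous_on (closure S) Du"
    and ball: "ball x1 d \<subseteq> S" and \<rho>: "0 < \<rho>" "\<rho> < d" and "c \<ge> 0"
    and e: "norm e = 1" "u (x1 + d *\<^sub>R e) = 0"
    and bound: "\<And>y. y \<in> cball x1 d - ball x1 \<rho> \<Longrightarrow>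
      c * (1 / (norm (y - x1))\<^sup>2 - 1 / d\<^sup>2) \<le> u y"
  shows "Du (x1 + d *\<^sub>R e) \<bullet> e \<le> - 2 * c / d ^ 3"
proof (rule ccontr)
  define q where "q = (\<lambda>s. x1 + s *\<^sub>R e)"
  assume "\<not> ?thesis"
  then have gt: "Du (q d) \<bullet> e > - 2 * c / d ^ 3" by (simp add: q_def)
  have "d > 0" using \<rho> by simp
  have norm_q: "norm (q s - x1) = \<bar>s\<bar>" for s using e by (simp add: q_def)
  have q_in: "q s \<in> S" if "0 \<le> s" "s < d" for s
    using that e ball by (auto simp: q_def dist_norm subset_iff)
  have q_cl: "q ` {0..d} \<subseteq> closure S"
  proof -
    have "q ` {0..d} \<subseteq> cball x1 d"
      using e by (auto simp: q_def dist_norm)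
    also have "\<dots> = closure (ball x1 d)" using \<open>d > 0\<close> by simp
    also have "\<dots> \<subseteq> closure S" using ball by (rule closure_mono)
    finally show ?thesis .
  qed
  have q_cont: "continuous_on A q" for A unfolding q_def by (intro continuous_intros)
  have "continuous_on {0..d} (\<lambda>s. Du (q s) \<bullet> e)"
    by (intro continuous_intros continuous_on_compose2[OF cont(2) q_cont q_cl])
  then have "((\<lambda>s. Du (q s) \<bullet> e) \<longlongrightarrow> Du (q d) \<bullet> e) (at d within {0..d})"
    using \<open>d > 0\<close> by (auto simp: continuous_on_def)
  from order_tendstoD(1)[OF this gt]
  obtain \<delta> where \<delta>: "\<delta> > 0" "\<And>s. s \<in> {0..d} \<Longrightarrow> s \<noteq> d \<Longrightarrow> dist s d < \<delta> \<Longrightarrow>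
      Du (q s) \<bullet> e > - 2 * c / d ^ 3"
    unfolding eventually_at by blast
  define s where "s = max \<rho> (d - \<delta> / 2)"
  have s: "\<rho> \<le> s" "s < d" "d - s < \<delta>" using \<rho> \<delta> by (auto simp: s_def)
  have "\<exists>z>s. z < d \<and> u (q d) - u (q s) = (d - s) * (Du (q z) \<bullet> e)"
  proof (rule mvt[of s d "\<lambda>s. u (q s)" "\<lambda>z h. h * (Du (q z) \<bullet> e)"])
    show "s < d" by (rule s)
    have "continuous_on {0..d} (\<lambda>s. u (q s))"
      by (rule continuous_on_compose2[OF cont(1) q_cont q_cl])
    then show "continuous_on {s..d} (\<lambda>s. u (q s))"
      by (rule continuous_on_subset) (use s \<rho> in auto)
    fix z assume z: "s < z" "z < d"
    have "(u has_derivative (\<lambda>h. h \<bullet> Du (q z))) (at (q z))"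
      using gderiv[OF q_in[of z]] z s \<rho> by (simp add: gderiv_def)
    moreover have "(q has_derivative (\<lambda>h. h *\<^sub>R e)) (at z)"
      unfolding q_def by (auto intro!: derivative_eq_intros)
    ultimately have "((\<lambda>s. u (q s)) has_derivative (\<lambda>h. (h *\<^sub>R e) \<bullet> Du (q z))) (at z)"
      by (rule has_derivative_compose[rotated])
    then show "((\<lambda>s. u (q s)) has_derivative (\<lambda>h. h * (Du (q z) \<bullet> e))) (at z)"
      by (simp add: inner_commute)
  next
    fix z assume "s < z" "z < d" "u (q d) - u (q s) = (d - s) * (Du (q z) \<bullet> e)"
    then show "\<exists>z>s. z < d \<and> u (q d) - u (q s) = (d - s) * (Du (q z) \<bullet> e)" by blast
  qed
  then obtain z where z: "s < z" "z < d" "u (q d) - u (q s) = (d - s) * (Du (q z) \<bullet> e)"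
    by blast
  have uqd: "u (q d) = 0" using e by (simp add: q_def)
  have "q s \<in> cball x1 d - ball x1 \<rho>"
    using s \<rho> norm_q[of s] by (auto simp: dist_norm norm_minus_commute)
  then have lower: "c * (1 / s\<^sup>2 - 1 / d\<^sup>2) \<le> u (q s)"
    using bound[of "q s"] norm_q[of s] by simp
  have "2 * (d - s) / d ^ 3 \<le> 1 / s\<^sup>2 - 1 / d\<^sup>2"
  proof -
    have "0 < s" using s \<rho> by simp
    have "0 \<le> (d - s)\<^sup>2 * (d + 2 * s)" using s \<open>0 < s\<close> by simp
    also have "(d - s)\<^sup>2 * (d + 2 * s) = d * (d\<^sup>2 - s\<^sup>2) - 2 * (d - s) * s\<^sup>2"
      by (simp add: power2_eq_square algebra_simps)
    finally have "2 * (d - s) * s\<^sup>2 \<le> d * (d\<^sup>2 - s\<^sup>2)" by simp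
    then have "2 * (d - s) * s\<^sup>2 / (d ^ 3 * s\<^sup>2) \<le> d * (d\<^sup>2 - s\<^sup>2) / (d ^ 3 * s\<^sup>2)"
      using \<open>0 < s\<close> \<open>d > 0\<close> by (intro divide_right_mono) auto
    also have "\<dots> = (d\<^sup>2 - s\<^sup>2) / (s\<^sup>2 * d\<^sup>2)"
      using \<open>0 < s\<close> \<open>d > 0\<close> by (simp add: power2_eq_square power3_eq_cube)
    also have "\<dots> = 1 / s\<^sup>2 - 1 / d\<^sup>2"
      using \<open>0 < s\<close> \<open>d > 0\<close> by (simp add: diff_frac_eq)
    finally show ?thesis using \<open>0 < s\<close> by simp
  qed
  then have "c * (2 * (d - s) / d ^ 3) \<le> c * (1 / s\<^sup>2 - 1 / d\<^sup>2)"
    using \<open>c \<ge> 0\<close> by (rule mult_left_mono)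
  also note lower
  also have "c * (2 * (d - s) / d ^ 3) = (d - s) * (2 * c / d ^ 3)" by simp
  finally have "(d - s) * (Du (q z) \<bullet> e) \<le> (d - s) * (- 2 * c / d ^ 3)"
    using z(3) uqd by simp
  then have "Du (q z) \<bullet> e \<le> - 2 * c / d ^ 3"
    by (rule mult_left_le_imp_le) (use s in auto)
  moreover have "Du (q z) \<bullet> e > - 2 * c / d ^ 3"
    using z s \<rho> by (intro \<delta>) (auto simp: dist_real_def)
  ultimately show False by simp
qed


lemma extremal_solution_bounded:
  fixes u :: "real^2 \<Rightarrow> real"
  assumes \<Omega>: "open \<Omega>" "C2_boundary \<Omega>"
    and C2: "C2_closure \<Omega> u Du D2u"
    and eq: "\<And>x. x \<in> \<Omega> \<Longrightarrow> trace (D2u x) + f (u x) = 0 \<and> u x > 0"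
    and boundary: "\<And>p. p \<in> frontier \<Omega> \<Longrightarrow>
      u p = 0 \<and> (\<forall>\<nu>. outward_unit_normal \<Omega> p \<nu> \<longrightarrow> Du p \<bullet> \<nu> = \<alpha>)"
    and f: "\<And>t. t > 0 \<Longrightarrow> 0 \<le> f t \<and> f t \<le> b + L * t" "b \<ge> 0" "L \<ge> 0"
    and R: "R > 0" "\<And>x. \<not> ball x R \<subseteq> \<Omega>"
  obtains H where "H > 0" "\<And>x. x \<in> \<Omega> \<Longrightarrow> u x \<le> H"
proof
  define Q where "Q = 16 + R\<^sup>2 * (b + 4 * L) / 8"
  have Q: "Q \<ge> 16" using f by (simp add: Q_def)
  show "max 1 (64 * Q\<^sup>2 * R * (- \<alpha>)) > 0" by simp
  fix x0 assume x0: "x0 \<in> \<Omega>"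
  have C2': "\<And>x. x \<in> \<Omega> \<Longrightarrow> GDERIV u x :> Du x \<and> (Du has_derivative (\<lambda>h. D2u x *v h)) (at x)"
    and cont: "continuous_on (closure \<Omega>) u" "continuous_on (closure \<Omega>) Du"
    using C2 unfolding C2_closure_def by auto
  have "\<Omega> \<noteq> UNIV" using R(2) by auto
  have nonneg: "u x \<ge> 0" if "x \<in> closure \<Omega>" for x
  proof (cases "x \<in> \<Omega>")
    case True then show ?thesis using eq by (simp add: less_imp_le)
  next
    case False
    then have "x \<in> frontier \<Omega>" using that \<Omega>(1) by (simp add: frontier_def interior_open)
    then show ?thesis using boundary by simp
  qed
  have le_R: "d \<le> R" if "ball x d \<subseteq> \<Omega>" for x d
    using R(2)[of x] that by (meson not_less order_less_imp_le order_trans subset_ball)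
  obtain p0 where p0: "p0 \<in> frontier \<Omega>" "ball x0 (dist x0 p0) \<subseteq> \<Omega>"
    using interior_ball_touching_frontier[OF \<Omega>(1) x0 \<open>\<Omega> \<noteq> UNIV\<close>] by blast
  define d0 where "d0 = dist x0 p0"
  have not_frontier: "p \<notin> \<Omega>" if "p \<in> frontier \<Omega>" for p
    using that \<Omega>(1) by (simp add: frontier_def interior_open)
  have d0: "d0 > 0" using x0 not_frontier[OF p0(1)] by (auto simp: d0_def)
  show "u x0 \<le> max 1 (64 * Q\<^sup>2 * R * (- \<alpha>))"
  proof (cases "u x0 \<le> 1")
    case True then show ?thesis by simp
  next
    case False
    have cball_cl: "cball x d \<subseteq> closure \<Omega>" if "ball x d \<subseteq> \<Omega>" "d > 0" for x d
      using closure_mono[OF that(1)] that(2) by simp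
    text \<open>Point picking: the weight makes \<open>u\<close> at most \<open>4 * u x1\<close> on a ball around the maximum
      point \<open>x1\<close>.\<close>
    define G where "G = (\<lambda>y. (d0 - dist x0 y)\<^sup>2 * u y)"
    have "continuous_on (cball x0 d0) G"
      unfolding G_def
      by (intro continuous_intros continuous_on_subset[OF cont(1)] cball_cl d0)
         (use p0 in \<open>simp add: d0_def\<close>)
    then obtain x1 where x1: "x1 \<in> cball x0 d0"
      and max: "\<And>y. y \<in> cball x0 d0 \<Longrightarrow> G y \<le> G x1"
      using continuous_attains_sup[of "cball x0 d0" G] d0 by auto
    define \<sigma> where "\<sigma> = d0 - dist x0 x1"
    have G1: "d0\<^sup>2 * u x0 \<le> \<sigma>\<^sup>2 * u x1"
      using max[of x0] d0 by (simp add: G_def \<sigma>_def)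
    have "d0\<^sup>2 * u x0 > 0" using d0 False by simp
    then have "\<sigma> \<noteq> 0" using G1 by auto
    then have \<sigma>: "\<sigma> > 0" "\<sigma> \<le> d0" using x1 by (auto simp: \<sigma>_def)
    have x1\<Omega>: "x1 \<in> \<Omega>" using \<sigma> p0(2) by (auto simp: \<sigma>_def d0_def)
    have ux1: "u x1 > 0" using eq x1\<Omega> by simp
    have "u x0 \<le> u x1"
    proof -
      have "\<sigma>\<^sup>2 * u x1 \<le> d0\<^sup>2 * u x1"
        using \<sigma> ux1 by (intro mult_right_mono power_mono) auto
      then have "d0\<^sup>2 * u x0 \<le> d0\<^sup>2 * u x1" using G1 by linarith
      then show ?thesis using d0 by simp
    qed
    then have ux1_ge: "u x1 \<ge> 1" using False by simp
    define s where "s = \<sigma> / 2"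
    have s: "s > 0" "s \<le> R" using \<sigma> le_R[OF p0(2)] by (auto simp: s_def d0_def)
    have s_sub: "cball x1 s \<subseteq> \<Omega>" "y \<in> cball x1 s \<Longrightarrow> u y \<le> 4 * u x1" for y
    proof -
      have *: "dist x0 y \<le> d0 - s" if "y \<in> cball x1 s" for y
        using that dist_triangle[of x0 y x1] by (auto simp: s_def \<sigma>_def field_simps)
      show "cball x1 s \<subseteq> \<Omega>"
        using * s p0(2) by (force simp: d0_def)
      assume y: "y \<in> cball x1 s"
      have "u y > 0" using eq y \<open>cball x1 s \<subseteq> \<Omega>\<close> by auto
      have "s\<^sup>2 * u y \<le> (d0 - dist x0 y)\<^sup>2 * u y"
        using *[OF y] s \<open>u y > 0\<close> by (intro mult_right_mono power_mono) auto
      also have "\<dots> \<le> \<sigma>\<^sup>2 * u x1"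
        using max[of y] *[OF y] s by (simp add: G_def \<sigma>_def)
      also have "\<dots> = s\<^sup>2 * (4 * u x1)" by (simp add: s_def power_divide)
      finally show "u y \<le> 4 * u x1" using s by (simp add: mult_le_cancel_left)
    qed
    define A where "A = 4 * (4 * u x1) / s + s * (b + L * (4 * u x1)) / 8"
    have lip: "u x1 - u y \<le> A * norm (x1 - y)" if "y \<in> cball x1 (s/2)" for y
      unfolding A_def
    proof (rule superharmonic_lower_Lipschitz_at_center[OF \<Omega>(1) C2' s(1) s_sub(1)])
      show "4 * u x1 > 0" "b + L * (4 * u x1) \<ge> 0" using ux1 f by auto
      show "0 \<le> u z \<and> u z \<le> 4 * u x1" if "z \<in> cball x1 s" for z
        using that s_sub eq by (auto simp: less_imp_le simp del: mem_cball)
      show "- (b + L * (4 * u x1)) \<le> trace (D2u z) \<and> trace (D2u z) \<le> 0"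
        if z: "z \<in> cball x1 s" for z
      proof -
        have z\<Omega>: "z \<in> \<Omega>" using z s_sub by blast
        have "L * u z \<le> L * (4 * u x1)" using f s_sub(2)[OF z] by (intro mult_left_mono) auto
        then show ?thesis using eq[OF z\<Omega>] f(1)[of "u z"] by linarith
      qed
    qed (use that in auto)
    have A: "A \<le> u x1 / s * Q"
    proof -
      have "b * 1 \<le> b * u x1" using f ux1_ge by (intro mult_left_mono) auto
      then have "b + L * (4 * u x1) \<le> u x1 * (b + 4 * L)" by (simp add: algebra_simps)
      then have "s\<^sup>2 * (b + L * (4 * u x1)) \<le> R\<^sup>2 * (u x1 * (b + 4 * L))"
        using s f ux1 by (intro mult_mono power_mono) auto
      then have "(16 * u x1 + s\<^sup>2 * (b + L * (4 * u x1)) / 8) / s \<le> (u x1 * Q) / s"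
        using s by (intro divide_right_mono) (auto simp: Q_def algebra_simps)
      moreover have "A = (16 * u x1 + s\<^sup>2 * (b + L * (4 * u x1)) / 8) / s"
        using s by (simp add: A_def field_simps power2_eq_square)
      ultimately show ?thesis by simp
    qed
    define \<rho> where "\<rho> = s / (2 * Q)"
    have \<rho>: "\<rho> > 0" "\<rho> \<le> s / 2"
      using s Q divide_left_mono[of 2 "2 * Q" s] by (auto simp: \<rho>_def)
    have half: "u x1 / 2 \<le> u y" if "y \<in> sphere x1 \<rho>" for y
    proof -
      have "norm (x1 - y) = \<rho>" using that by (simp add: dist_norm)
      then have "u x1 - u y \<le> A * \<rho>" using lip[of y] that \<rho> by simp
      also have "\<dots> \<le> u x1 / s * Q * \<rho>" using A \<rho> by (intro mult_right_mono) auto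
      also have "\<dots> = u x1 / 2" using s Q by (simp add: \<rho>_def)
      finally show ?thesis by simp
    qed
    obtain p where p: "p \<in> frontier \<Omega>" "ball x1 (dist x1 p) \<subseteq> \<Omega>"
      using interior_ball_touching_frontier[OF \<Omega>(1) x1\<Omega> \<open>\<Omega> \<noteq> UNIV\<close>] by blast
    define d where "d = dist x1 p"
    have d: "d > 0" "ball x1 d \<subseteq> \<Omega>" "d \<le> R"
      using x1\<Omega> not_frontier[OF p(1)] p(2) le_R by (auto simp: d_def)
    have d_le: "d \<le> 2 * d0"
    proof (rule ccontr)
      assume "\<not> d \<le> 2 * d0"
      then have "p0 \<in> ball x1 d"
        using x1 dist_triangle[of x1 p0 x0] by (simp add: d0_def dist_commute)
      then show False using d(2) not_frontier[OF p0(1)] by auto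
    qed
    have "p \<notin> cball x1 s" using s_sub(1) not_frontier[OF p(1)] by blast
    then have "\<rho> < d" using \<rho> s by (auto simp: d_def)
    define c where "c = u x1 / 2 * \<rho>\<^sup>2"
    have bound: "c * (1 / (norm (y - x1))\<^sup>2 - 1 / d\<^sup>2) \<le> u y"
      if "y \<in> cball x1 d - ball x1 \<rho>" for y
      unfolding c_def
    proof (rule superharmonic_annulus_lower_bound[OF \<Omega>(1) C2' _ d(2) \<rho>(1) _ _ _ half that])
      show "continuous_on (cball x1 d) u"
        by (rule continuous_on_subset[OF cont(1) cball_cl[OF d(2,1)]])
      show "trace (D2u z) \<le> 0" if "z \<in> ball x1 d" for z
      proof -
        have "z \<in> \<Omega>" using that d by blast
        then show ?thesis using eq[of z] f(1)[of "u z"] by linarith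
      qed
      show "u z \<ge> 0" if "z \<in> cball x1 d" for z
        using that cball_cl[OF d(2,1)] nonneg by blast
    qed (use ux1 in auto)
    define e where "e = (p - x1) /\<^sub>R d"
    have e: "norm e = 1" "x1 + d *\<^sub>R e = p"
      using d(1) by (auto simp: e_def d_def dist_norm norm_minus_commute)
    obtain \<tau> n g where "below_C2_graph \<Omega> p \<tau> n g"
      using \<Omega>(2) p(1) unfolding C2_boundary_def by blast
    then have "outward_unit_normal \<Omega> p e"
      by (rule outward_normal_of_interior_ball[OF _ not_frontier[OF p(1)] d(2,1) e(1) e(2)[symmetric]])
    then have "Du p \<bullet> e = \<alpha>" using boundary[OF p(1)] by blast
    moreover have "Du (x1 + d *\<^sub>R e) \<bullet> e \<le> - 2 * c / d ^ 3"
      by (rule boundary_slope_of_annulus_lower_bound[OF _ cont d(2) \<rho>(1) \<open>\<rho> < d\<close> _ e(1) _ bound])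
         (use C2' ux1 e boundary[OF p(1)] in \<open>auto simp: c_def\<close>)
    ultimately have slope: "2 * c / d ^ 3 \<le> - \<alpha>" by (simp add: e(2))
    have "d\<^sup>2 * u x0 \<le> (2 * d0)\<^sup>2 * u x0"
      using d d_le False by (intro mult_right_mono power_mono) auto
    also have "\<dots> = 4 * (d0\<^sup>2 * u x0)" by (simp add: power_mult_distrib)
    also have "\<dots> \<le> 4 * (\<sigma>\<^sup>2 * u x1)" using G1 by simp
    also have "\<dots> = 64 * Q\<^sup>2 * (2 * c)"
      using Q by (simp add: c_def \<rho>_def s_def field_simps power2_eq_square)
    also have "\<dots> \<le> 64 * Q\<^sup>2 * (- \<alpha> * d ^ 3)"
      using slope d by (intro mult_left_mono) (auto simp: pos_divide_le_eq)
    also have "\<dots> = d\<^sup>2 * (64 * Q\<^sup>2 * d * (- \<alpha>))"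
      by (simp add: power2_eq_square power3_eq_cube)
    finally have "u x0 \<le> 64 * Q\<^sup>2 * d * (- \<alpha>)"
      by (rule mult_left_le_imp_le) (use d in auto)
    also have "\<dots> \<le> 64 * Q\<^sup>2 * R * (- \<alpha>)"
    proof (intro mult_right_mono mult_left_mono)
      have "2 * c / d ^ 3 \<ge> 0" using d ux1 by (simp add: c_def)
      then show "0 \<le> - \<alpha>" using slope by linarith
    qed (use d in auto)
    finally show ?thesis by simp
  qed
qed

theorem theorem2p3:
  fixes f :: "real \<Rightarrow> real" and l :: real
    and \<Omega> :: "(real^2) set" and u :: "real^2 \<Rightarrow> real"
  assumes lipschitz: "\<exists>L. L-lipschitz_on {0..} f"
    and l_pos: "l > 0"
    and f_ge: "\<And>t. t > 0 \<Longrightarrow> f t \<ge> l * t"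
    and domain: "extremal_domain f \<Omega>"
    and solution: "extremal_solution f \<Omega> u"
  shows "\<exists>R>0. (\<forall>c. \<not> cball c R \<subseteq> closure \<Omega>) \<and>
           (\<exists>h0>0. \<forall>C\<in>components {x\<in>\<Omega>. u x > h0}. \<exists>c. C \<subseteq> ball c (sqrt 5 / 2 * R))"
proof -
  have \<Omega>: "open \<Omega>" "C2_boundary \<Omega>" using domain by (auto simp: extremal_domain_def)
  from solution[unfolded extremal_solution_def]
  obtain \<alpha> Du D2u where C2: "C2_closure \<Omega> u Du D2u"
    and ball_eq: "\<forall>x\<in>\<Omega>. trace (D2u x) + f (u x) = 0 \<and> u x > 0"
    and ball_boundary: "\<forall>p\<in>frontier \<Omega>.
      u p = 0 \<and> (\<forall>\<nu>. outward_unit_normal \<Omega> p \<nu> \<longrightarrow> Du p \<bullet> \<nu> = \<alpha>)"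
    by (elim exE conjE) (rule that)
  note eq = ball_eq[rule_format] and boundary = bspec[OF ball_boundary]
  obtain L where L: "L-lipschitz_on {0..} f" using lipschitz by blast
  define R where "R = 3 * pi / sqrt l"
  have R_pos: "R > 0" using l_pos by (simp add: R_def)
  have no_ball: "\<not> ball c R \<subseteq> \<Omega>" for c
    unfolding R_def
  proof (rule positive_supersolution_no_large_ball[OF \<Omega>(1)])
    show "GDERIV u x :> Du x \<and> (Du has_derivative (\<lambda>h. D2u x *v h)) (at x)" if "x \<in> \<Omega>" for x
      using that C2 unfolding C2_closure_def by blast
    show "trace (D2u x) + l * u x \<le> 0" if "x \<in> \<Omega>" for x
      using eq[OF that] f_ge[of "u x"] by linarith
  qed (use eq l_pos in auto)
  have "\<not> cball c R \<subseteq> closure \<Omega>" for c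
  proof
    assume "cball c R \<subseteq> closure \<Omega>"
    then have "ball c R \<subseteq> interior (closure \<Omega>)"
      by (intro interior_maximal) auto
    then show False using no_ball by (simp add: interior_closure_C2_boundary[OF \<Omega>])
  qed
  moreover have "\<exists>H>0. \<forall>x\<in>\<Omega>. u x \<le> H"
  proof (rule extremal_solution_bounded[OF \<Omega> C2 eq boundary _ _ _ R_pos no_ball])
    show "0 \<le> f t \<and> f t \<le> \<bar>f 0\<bar> + L * t" if "t > 0" for t
    proof -
      have "dist (f t) (f 0) \<le> L * dist t 0"
        using that by (intro lipschitz_onD[OF L]) auto
      moreover have "l * t > 0" using l_pos that by simp
      ultimately show ?thesis using f_ge[OF that] that by (auto simp: dist_real_def)
    qed
    show "L \<ge> 0" using L by (rule lipschitz_on_nonneg)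
  qed auto
  then obtain H where "H > 0" "\<forall>x\<in>\<Omega>. u x \<le> H" by blast
  then have "components {x\<in>\<Omega>. u x > H} = {}" by (force simp: components_eq_empty)
  then have "\<exists>h0>0. \<forall>C\<in>components {x\<in>\<Omega>. u x > h0}. \<exists>c. C \<subseteq> ball c (sqrt 5 / 2 * R)"
    using \<open>H > 0\<close> by (metis empty_iff)
  ultimately show ?thesis using R_pos by blast
qed

end
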